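(* Let $v=2m$ or $v=2m+1$ with $m\geq 2$, and let $1\leq k<m$. Let $1\leq z_1\leq k$ and $1\leq z_2\leq m$, and let $L=(L^*\setminus\{k,k+1\})\cup\{z_1,z_2\}$ (multiset operations: remove one copy of $k$ and one copy of $k+1$, add $z_1$ and $z_2$). Then $\mathrm{BHR}(L)$ holds; in particular there exists a Hamiltonian path $H$ of $K_v$ with $\ell(H)=L$.
   Context: $K_v$ is the complete graph on vertex set $\{0,1,\ldots,v-1\}$; the length of an edge $[x,y]$ is $\min(|x-y|,v-|x-y|)$ and $\ell(H)$ is the multiset of edge lengths of $H$. If $v=2m+1$, $L^*=\{1^2,2^2,\ldots,m^2\}$; if $v=2m$, $L^*=\{1^2,2^2,\ldots,(m-1)^2,m^1\}$, where $i^{a}$ denotes $a$ copies of $i$. For a list $L$ of $v-1$ positive integers not exceeding $\lfloor v/2\rfloor$, $\mathrm{BHR}(L)$ is the statement: there exists a Hamiltonian path $H$ of $K_v$ with $\ell(H)=L$ if and only if for every divisor $d$ of $v$ the number of elements of $L$ (with multiplicity) that are multiples of $d$ is at most $v-d$. *)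

theory Defs
  imports "HOL-Library.Multiset"
begin

definition complete_edges :: "nat \<Rightarrow> nat set set" where
  "complete_edges v = {{x, y} | x y. x < v \<and> y < v \<and> x \<noteq> y}"

text \<open>A Hamiltonian path of the graph \<open>(V, E)\<close> is given by its sequence of vertices.\<close>

definition hamiltonian_path :: "'a set \<Rightarrow> 'a set set \<Rightarrow> 'a list \<Rightarrow> bool" where
  "hamiltonian_path V E xs \<longleftrightarrow>
     set xs = V \<and> distinct xs \<and> successively (\<lambda>x y. {x, y} \<in> E) xs"

definition edge_length :: "nat \<Rightarrow> nat \<Rightarrow> nat \<Rightarrow> nat" where
  "edge_length v x y = nat (min \<bar>int x - int y\<bar> (int v - \<bar>int x - int y\<bar>))"

definition path_lengths :: "nat \<Rightarrow> nat list \<Rightarrow> nat multiset" where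
  "path_lengths v xs = mset (map (\<lambda>(x, y). edge_length v x y) (zip xs (tl xs)))"

definition realizable :: "nat \<Rightarrow> nat multiset \<Rightarrow> bool" where
  "realizable v L \<longleftrightarrow>
     (\<exists>xs. hamiltonian_path {0..<v} (complete_edges v) xs \<and> path_lengths v xs = L)"

definition admissible_list :: "nat \<Rightarrow> nat multiset \<Rightarrow> bool" where
  "admissible_list v L \<longleftrightarrow> size L = v - 1 \<and> (\<forall>l\<in>#L. 1 \<le> l \<and> l \<le> v div 2)"

text \<open>
  \<open>BHR\<close> is only meaningful for \<open>L\<close> with \<open>admissible_list v L\<close>. For \<open>v > 0\<close> the subtraction
  \<open>v - d\<close> does not truncate, since \<open>d\<close> divides \<open>v\<close>.
\<close>

definition BHR :: "nat \<Rightarrow> nat multiset \<Rightarrow> bool" where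
  "BHR v L \<longleftrightarrow>
     (realizable v L \<longleftrightarrow> (\<forall>d. d dvd v \<longrightarrow> size {#l \<in># L. d dvd l#} \<le> v - d))"

definition Lstar :: "nat \<Rightarrow> nat multiset" where
  "Lstar v = (let m = v div 2 in
     if odd v then (\<Sum>i\<in>{1..m}. replicate_mset 2 i)
     else (\<Sum>i\<in>{1..<m}. replicate_mset 2 i) + {#m#})"

lemma count_Lstar:
  assumes "v \<ge> 2"
  shows "count (Lstar v) i =
    (if 1 \<le> i \<and> i \<le> v div 2 then (if 2 * i = v then 1 else 2) else 0)"
  using assms by (auto simp: Lstar_def Let_def count_sum sum.delta)

lemma size_Lstar:
  assumes "v \<ge> 2"
  shows "size (Lstar v) = v - 1"
proof -
  have s: "size (\<Sum>i\<in>A. replicate_mset 2 i) = 2 * card A" if "finite A" for A :: "nat set"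
    using that by (induction rule: finite_induct) auto
  show ?thesis
    using assms by (auto simp: Lstar_def Let_def s elim!: oddE evenE)
qed

text \<open>The list to which \<open>BHR\<close> is applied in the theorem lies in the domain of \<open>BHR\<close>.\<close>

lemma admissible_L:
  assumes "v = 2 * m \<or> v = 2 * m + 1" "m \<ge> 2" "1 \<le> k" "k < m"
    and "1 \<le> z1" "z1 \<le> k" "1 \<le> z2" "z2 \<le> m"
    and L: "L = (Lstar v - {#k, k + 1#}) + {#z1, z2#}"
  shows "admissible_list v L"
proof -
  have v: "v \<ge> 2" "v div 2 = m" using assms by auto
  have sub: "{#k, k + 1#} \<subseteq># Lstar v"
    using assms v by (auto simp: subseteq_mset_def count_Lstar)
  have "size L = v - 1"
    using sub size_Lstar[OF v(1)] v size_mset_mono[OF sub] assms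
    by (simp add: L size_Diff_submset)
  moreover have "1 \<le> l \<and> l \<le> v div 2" if "l \<in># L" for l
  proof -
    have "l \<in># Lstar v \<or> l = z1 \<or> l = z2"
      using that by (auto simp: L dest: in_diffD)
    moreover have "1 \<le> l \<and> l \<le> v div 2" if "l \<in># Lstar v"
      using that count_Lstar[OF v(1), of l]
      by (auto simp: count_greater_zero_iff[symmetric] simp del: count_greater_zero_iff
          split: if_splits)
    ultimately show ?thesis using assms v by auto
  qed
  ultimately show ?thesis by (auto simp: admissible_list_def)
qed

end

theory Submission
  imports Defs
begin

text \<open>
  Removing one edge of length \<open>k\<close> and one of length \<open>k + 1\<close> from the zigzag path realizing
  \<open>Lstar v\<close> isolates the vertex \<open>k\<close> between two intervals, each carrying a path whose differences
  are \<open>1, 2, \<dots>\<close>, i.e. a graceful labelling of a path. Any other graceful labellings of the two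
  intervals use the same lengths, so it suffices to choose them to end at distance \<open>z1\<close>,
  respectively \<open>z2\<close>, from \<open>k\<close>. Hence everything follows from the fact that a path has a graceful
  labelling with any prescribed end label, which is obtained by peeling off an outer zigzag and
  recursing. When the end label is too close to the middle for this, one reflects the small and
  the large labels separately, which is possible if small and large labels alternate along the path.
\<close>

section \<open>Graceful labellings of paths\<close>

fun diffs :: "nat list \<Rightarrow> nat list" where
  "diffs (x # y # zs) = nat \<bar>int x - int y\<bar> # diffs (y # zs)"
| "diffs _ = []"

lemma length_diffs [simp]: "length (diffs xs) = length xs - 1"
  by (induction xs rule: diffs.induct) auto

lemma diffs_append:
  "xs \<noteq> [] \<Longrightarrow> ys \<noteq> [] \<Longrightarrow>
    diffs (xs @ ys) = diffs xs @ nat \<bar>int (last xs) - int (hd ys)\<bar> # diffs ys"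
proof (induction xs rule: diffs.induct)
  case ("2_2" x)
  then show ?case by (cases ys) auto
qed auto

lemma diffs_rev: "diffs (rev xs) = rev (diffs xs)"
proof (induction xs rule: diffs.induct)
  case (1 x y zs)
  have "diffs (rev (x # y # zs)) = diffs (rev (y # zs) @ [x])" by simp
  also have "\<dots> = diffs (rev (y # zs)) @ [nat \<bar>int x - int y\<bar>]"
    by (subst diffs_append) (auto simp: last_rev abs_minus_commute)
  finally show ?case using 1 by simp
qed auto

lemma diffs_shift: "diffs (map (\<lambda>x. x + c) xs) = diffs xs"
  by (induction xs rule: diffs.induct) auto

lemma diffs_complement: "set xs \<subseteq> {0..<n} \<Longrightarrow> diffs (map (\<lambda>x. n - 1 - x) xs) = diffs xs"
  by (induction xs rule: diffs.induct) (auto simp: of_nat_diff)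

text \<open>By counting, the two set equations force the labels and the differences to be pairwise
  distinct.\<close>

definition graceful_path :: "nat \<Rightarrow> nat list \<Rightarrow> bool" where
  "graceful_path n xs \<longleftrightarrow> length xs = n \<and> set xs = {0..<n} \<and> set (diffs xs) = {1..<n}"

lemma graceful_path_distinct: "graceful_path n xs \<Longrightarrow> distinct xs"
  by (rule card_distinct) (simp add: graceful_path_def)

lemma graceful_path_mset_diffs: "graceful_path n xs \<Longrightarrow> mset (diffs xs) = mset_set {1..<n}"
  using mset_set_set[OF card_distinct, of "diffs xs"] by (simp add: graceful_path_def)

lemma complement_image: "(\<lambda>x. n - 1 - x) ` {0..<n} = {0..<n::nat}"
proof -
  have "x \<in> (\<lambda>x. n - 1 - x) ` {0..<n}" if "x < n" for x
    using that by (intro image_eqI[of _ _ "n - 1 - x"]) auto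
  then show ?thesis by auto
qed

lemma graceful_path_complement:
  "graceful_path n xs \<Longrightarrow> graceful_path n (map (\<lambda>x. n - 1 - x) xs)"
  unfolding graceful_path_def by (simp only: length_map set_map diffs_complement complement_image)

abbreviation crossing :: "nat \<Rightarrow> nat list \<Rightarrow> bool" where
  "crossing p \<equiv> successively (\<lambda>x y. (x < p) \<noteq> (y < p))"

text \<open>
  This is an \<open>\<alpha>\<close>-labelling of a path in the sense of Rosa; by alternation, \<open>(n + 1) div 2\<close> is the
  only possible threshold for a path that starts with a small label.
\<close>

definition alpha_path :: "nat \<Rightarrow> nat list \<Rightarrow> bool" where
  "alpha_path n xs \<longleftrightarrow> graceful_path n xs \<and> crossing ((n + 1) div 2) xs"

section \<open>Reflecting small and large labels separately\<close>

lemma flip_image: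
  fixes n p :: nat
  assumes "p \<le> n"
  shows "(\<lambda>x. if x < p then p - 1 - x else n + p - 1 - x) ` {0..<n} = {0..<n}" (is "?f ` _ = _")
proof -
  have "x \<in> ?f ` {0..<n}" if "x < n" for x
    using that assms by (intro image_eqI[of _ _ "?f x"]) auto
  then have "{0..<n} \<subseteq> ?f ` {0..<n}" by (meson atLeastLessThan_iff subsetI)
  moreover have "?f ` {0..<n} \<subseteq> {0..<n}" using assms by auto
  ultimately show ?thesis by (rule subset_antisym[rotated])
qed

text \<open>For \<open>x < p\<close> and \<open>p \<le> y\<close> the difference
  \<open>y - x\<close> becomes \<open>(n + p - 1 - y) - (p - 1 - x)\<close>, which is
  \<open>n - (y - x)\<close>. A pair on one side of \<open>p\<close> would keep its difference,
  hence the crossing hypothesis.\<close>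

lemma diffs_flip:
  fixes n p :: nat
  assumes "p \<le> n" "crossing p xs" "set xs \<subseteq> {0..<n}"
  shows "diffs (map (\<lambda>x. if x < p then p - 1 - x else n + p - 1 - x) xs) =
    map (\<lambda>d. n - d) (diffs xs)"
  using assms by (induction xs rule: diffs.induct) (auto simp: of_nat_diff)

lemma crossing_flip:
  fixes n p :: nat
  assumes "p \<le> n" "crossing p xs" "set xs \<subseteq> {0..<n}"
  shows "crossing p (map (\<lambda>x. if x < p then p - 1 - x else n + p - 1 - x) xs)"
  using assms by (induction xs rule: diffs.induct) auto

lemma alpha_path_flip:
  assumes "alpha_path n xs" "p = (n + 1) div 2"
  shows "alpha_path n (map (\<lambda>x. if x < p then p - 1 - x else n + p - 1 - x) xs)"
proof -
  have p: "p \<le> n" using assms(2) by simp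
  have xs: "crossing p xs" "set xs = {0..<n}" "set (diffs xs) = {1..<n}" "length xs = n"
    using assms by (auto simp: alpha_path_def graceful_path_def)
  have "x \<in> (\<lambda>d. n - d) ` {1..<n}" if "1 \<le> x" "x < n" for x
    using that by (intro image_eqI[of _ _ "n - x"]) auto
  then have "(\<lambda>d. n - d) ` {1..<n} = {1..<n}" by auto
  then show ?thesis
    using xs p crossing_flip[OF p, of xs] diffs_flip[OF p, of xs] flip_image[OF p] assms(2)
    by (auto simp: alpha_path_def graceful_path_def)
qed

section \<open>Zigzags and extension of labellings by an outer zigzag\<close>

fun zigzag :: "nat \<Rightarrow> nat \<Rightarrow> nat list" where
  "zigzag 0 x = [0]"
| "zigzag (Suc i) x = Suc i # x # zigzag i (Suc x)"

lemma zigzag_nonempty [simp]: "zigzag i x \<noteq> []"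
  by (cases i) auto

lemma hd_zigzag [simp]: "hd (zigzag i x) = i"
  by (cases i) auto

lemma last_zigzag [simp]: "last (zigzag i x) = 0"
  by (induction i x rule: zigzag.induct) auto

lemma length_zigzag [simp]: "length (zigzag i x) = 2 * i + 1"
  by (induction i x rule: zigzag.induct) auto

lemma set_zigzag: "set (zigzag i x) = {0..i} \<union> {x..<x + i}"
  by (induction i x rule: zigzag.induct) auto

text \<open>The sequence is \<open>i, x, i - 1, x + 1, ..., 1, x + i - 1, 0\<close>, so the
  differences grow by one at each step, starting from \<open>x - i\<close>.\<close>

lemma set_diffs_zigzag: "i < x \<Longrightarrow> set (diffs (zigzag i x)) = {x - i..<x + i}"
proof (induction i x rule: zigzag.induct)
  case (2 i x)
  have "diffs (zigzag (Suc i) x) = (x - Suc i) # (x - i) # diffs (zigzag i (Suc x))"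
    using 2(2) hd_zigzag[of i "Suc x"]
    by (cases "zigzag i (Suc x)") (auto simp: nat_diff_distrib')
  then show ?case using 2 by auto
qed auto

lemma crossing_zigzag: "i < p \<Longrightarrow> p \<le> x \<Longrightarrow> crossing p (zigzag i x)"
proof (induction i x rule: zigzag.induct)
  case (2 i x)
  then show ?case
    using hd_zigzag[of i "Suc x"] by (cases "zigzag i (Suc x)") auto
qed auto

text \<open>The zigzag takes the \<open>i + 1\<close> smallest and \<open>i\<close> largest labels
  and the differences above \<open>n'\<close>. It ends at \<open>0\<close> and the shifted inner
  path starts at \<open>n'\<close>, so the joining edge supplies \<open>n'\<close> itself.\<close>

lemma graceful_path_odd_extend:
  assumes ys: "graceful_path n' ys" and hd: "hd ys = n' - 1 - i" and i: "i < n'"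
  defines "n \<equiv> n' + 2 * i + 1"
  shows "graceful_path n (zigzag i (n - i) @ map (\<lambda>x. x + (i + 1)) ys)"
proof -
  have y: "ys \<noteq> []" "length ys = n'" "set ys = {0..<n'}" "set (diffs ys) = {1..<n'}"
    using ys i by (auto simp: graceful_path_def)
  define zs where "zs = map (\<lambda>x. x + (i + 1)) ys"
  have "set zs = {i + 1..<n' + (i + 1)}"
    using image_add_atLeastLessThan'[of "i + 1" 0 n'] y by (simp only: zs_def set_map add_0)
  moreover have "zs \<noteq> []" "length zs = n'" "diffs zs = diffs ys"
    using y by (auto simp only: zs_def diffs_shift length_map list.map_disc_iff)
  ultimately have z: "zs \<noteq> []" "length zs = n'" "set zs = {i + 1..<n' + (i + 1)}"
    "set (diffs zs) = {1..<n'}" "diffs zs = diffs ys"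
    using y by auto
  have "hd zs = n'"
    using y hd i by (simp add: zs_def hd_map)
  then have "set (diffs (zigzag i (n - i) @ zs)) = {n - 2 * i..<n} \<union> {n'} \<union> {1..<n'}"
    using z i by (subst diffs_append) (auto simp: set_diffs_zigzag n_def)
  also have "\<dots> = {1..<n}" using i by (auto simp: n_def)
  finally show ?thesis
    unfolding zs_def[symmetric] using z by (auto simp: graceful_path_def set_zigzag n_def)
qed

text \<open>The label \<open>n - 1\<close> is inserted after the zigzag: the edge from
  \<open>0\<close> supplies \<open>n - 1\<close>, and the edge to the shifted start
  \<open>2 * i + 1\<close> supplies \<open>n'\<close>.\<close>

lemma graceful_path_even_extend:
  assumes ys: "graceful_path n' ys" and hd: "hd ys = i" and i: "i < n'"
  defines "n \<equiv> n' + 2 * i + 2"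
  shows "graceful_path n (zigzag i (n - 1 - i) @ (n - 1) # map (\<lambda>x. x + (i + 1)) ys)"
proof -
  have y: "ys \<noteq> []" "length ys = n'" "set ys = {0..<n'}" "set (diffs ys) = {1..<n'}"
    using ys i by (auto simp: graceful_path_def)
  define zs where "zs = map (\<lambda>x. x + (i + 1)) ys"
  have "set zs = {i + 1..<n' + (i + 1)}"
    using image_add_atLeastLessThan'[of "i + 1" 0 n'] y by (simp only: zs_def set_map add_0)
  moreover have "zs \<noteq> []" "length zs = n'" "diffs zs = diffs ys"
    using y by (auto simp only: zs_def diffs_shift length_map list.map_disc_iff)
  ultimately have z: "zs \<noteq> []" "length zs = n'" "set zs = {i + 1..<n' + (i + 1)}"
    "set (diffs zs) = {1..<n'}" "diffs zs = diffs ys"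
    using y by auto
  have h: "hd zs = 2 * i + 1"
    using y hd i by (simp add: zs_def hd_map)
  have "diffs ((n - 1) # zs) = n' # diffs zs"
    using diffs_append[of "[n - 1]" zs] z h by (simp add: n_def)
  then have "set (diffs (zigzag i (n - 1 - i) @ (n - 1) # zs)) =
      {n - 1 - 2 * i..<n - 1} \<union> {n - 1} \<union> ({n'} \<union> {1..<n'})"
    using z i by (subst diffs_append) (auto simp: set_diffs_zigzag n_def)
  also have "\<dots> = {1..<n}" using i by (auto simp: n_def)
  finally show ?thesis
    unfolding zs_def[symmetric] using z by (auto simp: graceful_path_def set_zigzag n_def)
qed

text \<open>The zigzag ends at the small label \<open>0\<close>, so alternation requires a large
  label next; hence the inner path is complemented. Complement and shift carry its threshold to
  \<open>n' div 2 + i + 1\<close>, the outer one.\<close>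

lemma alpha_path_odd_extend:
  assumes ys: "alpha_path n' ys" and hd: "hd ys = i" and i: "2 * i < n'"
  shows "\<exists>xs. alpha_path (n' + 2 * i + 1) xs \<and> hd xs = i"
proof -
  define n where "n = n' + 2 * i + 1"
  define zs where "zs = map (\<lambda>x. n' - 1 - x) ys"
  have g: "graceful_path n' ys" and c: "crossing ((n' + 1) div 2) ys"
    using ys by (auto simp: alpha_path_def)
  have y: "ys \<noteq> []" "set ys = {0..<n'}" using g i by (auto simp: graceful_path_def)
  have gz: "graceful_path n' zs" unfolding zs_def by (rule graceful_path_complement[OF g])
  have hz: "hd zs = n' - 1 - i" using y hd by (simp add: zs_def hd_map)
  let ?p = "(n + 1) div 2" and ?xs = "zigzag i (n - i) @ map (\<lambda>x. x + (i + 1)) zs"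
  have p: "?p = n' div 2 + i + 1" by (simp add: n_def)
  have "crossing ?p (map (\<lambda>x. x + (i + 1)) zs)"
    unfolding zs_def successively_map
    using c by (rule successively_mono) (use y p in auto)
  moreover have "\<not> hd (map (\<lambda>x. x + (i + 1)) zs) < ?p"
    using y hz i p by (simp add: hd_map zs_def)
  moreover have "crossing ?p (zigzag i (n - i))"
    using i by (intro crossing_zigzag) (auto simp: n_def)
  ultimately have "crossing ?p ?xs"
    using p by (simp add: successively_append_iff)
  moreover have "graceful_path n ?xs"
    using graceful_path_odd_extend[OF gz hz] i by (simp add: n_def)
  ultimately show ?thesis
    by (auto simp: alpha_path_def n_def intro!: exI[of _ ?xs])
qed

text \<open>The large label \<open>n - 1\<close> now precedes the inner path, which may start small
  and is only shifted. As in the odd case, inner and outer path both start at \<open>i\<close>, so a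
  recursion changes only \<open>n\<close>.\<close>

lemma alpha_path_even_extend:
  assumes ys: "alpha_path n' ys" and hd: "hd ys = i" and i: "2 * i < n'"
  shows "\<exists>xs. alpha_path (n' + 2 * i + 2) xs \<and> hd xs = i"
proof -
  define n where "n = n' + 2 * i + 2"
  have g: "graceful_path n' ys" and c: "crossing ((n' + 1) div 2) ys"
    using ys by (auto simp: alpha_path_def)
  have y: "ys \<noteq> []" "set ys = {0..<n'}" using g i by (auto simp: graceful_path_def)
  let ?p = "(n + 1) div 2"
    and ?xs = "zigzag i (n - 1 - i) @ (n - 1) # map (\<lambda>x. x + (i + 1)) ys"
  have p: "?p = (n' + 1) div 2 + i + 1" by (simp add: n_def)
  have "crossing ?p (map (\<lambda>x. x + (i + 1)) ys)"
    unfolding successively_map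
    using c by (rule successively_mono) (use p in auto)
  moreover have "hd (map (\<lambda>x. x + (i + 1)) ys) < ?p"
    using y hd i p by (simp add: hd_map)
  moreover have "crossing ?p (zigzag i (n - 1 - i))"
    using i by (intro crossing_zigzag) (auto simp: n_def)
  moreover have "\<not> n - 1 < ?p" using i by (simp add: n_def)
  ultimately have "crossing ?p ?xs"
    using p by (simp add: successively_append_iff successively_Cons)
  moreover have "graceful_path n ?xs"
    using graceful_path_even_extend[OF g hd] i by (simp add: n_def)
  ultimately show ?thesis
    by (auto simp: alpha_path_def n_def intro!: exI[of _ ?xs])
qed

text \<open>
  The condition \<open>n \<noteq> 4 * i + 1\<close> excludes the fixed points of the flip; for \<open>n = 5\<close> and \<open>i = 1\<close> the
  conclusion is in fact false. The two extensions differ by one in \<open>n\<close>, so the recursion can always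
  avoid these cases.
\<close>

lemma alpha_path_exists:
  assumes "2 * i < n" "n \<noteq> 4 * i + 1 \<or> i = 0"
  shows "\<exists>xs. alpha_path n xs \<and> hd xs = i"
  using assms
proof (induction n arbitrary: i rule: less_induct)
  case (less n)
  have large: "\<exists>xs. alpha_path n xs \<and> hd xs = i" if i: "4 * i + 2 \<le> n" for i
  \<comment> \<open>The odd extension recurses to \<open>n - 2 * i - 1\<close>, which is the
    excluded \<open>4 * i + 1\<close> exactly when \<open>n = 6 * i + 2\<close>; the even extension
    then recurses to \<open>4 * i\<close> instead.\<close>
  proof (cases "n = 6 * i + 2 \<and> i > 0")
    case True
    then obtain ys where "alpha_path (4 * i) ys" "hd ys = i"
      using less.IH[of "4 * i" i] by auto
    from alpha_path_even_extend[OF this] True show ?thesis by simp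
  next
    case False
    then have "n - 2 * i - 1 \<noteq> 4 * i + 1 \<or> i = 0" "n - 2 * i - 1 < n" "2 * i < n - 2 * i - 1"
      using i by auto
    then obtain ys where "alpha_path (n - 2 * i - 1) ys" "hd ys = i"
      using less.IH by blast
    from alpha_path_odd_extend[OF this] i show ?thesis by simp
  qed
  consider "n = 1" | "4 * i + 2 \<le> n" | "n \<noteq> 1" "n \<le> 4 * i"
    using less.prems by linarith
  then show ?case
  proof cases
    case 1
    then show ?thesis
      using less.prems by (auto simp: alpha_path_def graceful_path_def intro!: exI[of _ "[0]"])
  next
    case 2
    then show ?thesis by (rule large)
  next
    case 3
    \<comment> \<open>The flip exchanges the end labels \<open>i\<close> and
      \<open>p - 1 - i\<close>; since \<open>n \<le> 4 * i\<close>, the latter is small enough for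
      \<open>large\<close>.\<close>
    define p where "p = (n + 1) div 2"
    have ip: "i < p" using less.prems by (auto simp: p_def)
    have "2 * p \<le> n + 1" by (simp add: p_def)
    then have "4 * (p - 1 - i) + 2 \<le> n" using 3 ip by linarith
    then obtain xs where xs: "alpha_path n xs" "hd xs = p - 1 - i"
      using large by blast
    have "xs \<noteq> []" using xs less.prems by (auto simp: alpha_path_def graceful_path_def)
    then show ?thesis
      using alpha_path_flip[OF xs(1) p_def] xs(2) ip
      by (intro exI[of _ "map (\<lambda>x. if x < p then p - 1 - x else n + p - 1 - x) xs"])
        (auto simp: hd_map)
  qed
qed

lemma graceful_path_exists:
  assumes "i < n"
  shows "\<exists>xs. graceful_path n xs \<and> hd xs = i"
proof -
  have small: "\<exists>xs. graceful_path n xs \<and> hd xs = i" if i: "2 * i < n" for i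
  proof (cases "n = 4 * i + 1 \<and> i > 0")
    case True
    \<comment> \<open>The missing case \<open>n = 4 * i + 1\<close> is an odd extension with
      \<open>n' = 2 * i\<close>: the required inner start \<open>n' - 1 - i\<close> is
      \<open>i - 1\<close>, which is not an excluded end label by parity.\<close>
    then have "2 * (i - 1) < 2 * i" "2 * i \<noteq> 4 * (i - 1) + 1"
      by presburger+
    then obtain ys where "alpha_path (2 * i) ys" "hd ys = i - 1"
      using alpha_path_exists by blast
    then have "graceful_path (2 * i) ys" "hd ys = 2 * i - 1 - i"
      using True by (auto simp: alpha_path_def)
    from graceful_path_odd_extend[OF this] True show ?thesis
      by (intro exI, intro conjI) (assumption | auto)+
  next
    case False
    then show ?thesis
      using alpha_path_exists[OF i] by (auto simp: alpha_path_def)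
  qed
  show ?thesis
  proof (cases "2 * i < n")
    case False
    then have "2 * (n - 1 - i) < n" using assms by linarith
    then obtain xs where xs: "graceful_path n xs" "hd xs = n - 1 - i"
      using small by blast
    then have "xs \<noteq> []" using assms by (auto simp: graceful_path_def)
    then show ?thesis
      using graceful_path_complement[OF xs(1)] xs(2) assms
      by (intro exI[of _ "map (\<lambda>x. n - 1 - x) xs"]) (auto simp: hd_map)
  qed (rule small)
qed

section \<open>Edge lengths of Hamiltonian paths\<close>

lemma edge_length_eq_min:
  assumes "x < v" "y < v"
  shows "edge_length v x y = min (nat \<bar>int x - int y\<bar>) (v - nat \<bar>int x - int y\<bar>)"
proof -
  define a where "a = nat \<bar>int x - int y\<bar>"
  have a: "\<bar>int x - int y\<bar> = int a" "a \<le> v" using assms by (auto simp: a_def)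
  then have "int v - int a = int (v - a)" by (simp add: of_nat_diff)
  then show ?thesis by (simp add: edge_length_def a flip: of_nat_min)
qed

lemma path_lengths_Cons:
  "path_lengths v (x # y # zs) = add_mset (edge_length v x y) (path_lengths v (y # zs))"
  by (simp add: path_lengths_def)

lemma path_lengths_eq_diffs:
  "set xs \<subseteq> {0..<v} \<Longrightarrow> path_lengths v xs = image_mset (\<lambda>d. min d (v - d)) (mset (diffs xs))"
  by (induction xs rule: diffs.induct)
    (auto simp: path_lengths_Cons edge_length_eq_min, auto simp: path_lengths_def)

lemma image_mset_reflect:
  assumes "b \<le> v"
  shows "image_mset (\<lambda>d. v - d) (mset_set {v - b + 1..<v}) = mset_set {1..<b::nat}"
proof -
  have "x \<in> (\<lambda>d. v - d) ` {v - b + 1..<v}" if "1 \<le> x" "x < b" for x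
    using that assms by (intro image_eqI[of _ _ "v - x"]) auto
  then have "(\<lambda>d. v - d) ` {v - b + 1..<v} = {1..<b}" using assms by auto
  moreover have "inj_on (\<lambda>d. v - d) {v - b + 1..<v}" by (auto simp: inj_on_def)
  ultimately show ?thesis by (simp add: image_mset_mset_set)
qed

lemma image_mset_min_eq:
  fixes v :: nat
  assumes "\<And>d. d \<in># M \<Longrightarrow> 2 * d \<le> v"
  shows "image_mset (\<lambda>d. min d (v - d)) M = M"
proof -
  have "image_mset (\<lambda>d. min d (v - d)) M = image_mset (\<lambda>d. d) M"
    using assms by (intro image_mset_cong) fastforce
  then show ?thesis by simp
qed

text \<open>Folding fixes the differences up to \<open>v div 2\<close> and reflects the others; for
  even \<open>v\<close> only the fixed half contributes \<open>v div 2\<close>, hence its single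
  copy.\<close>

lemma Lstar_eq_image:
  assumes "v \<ge> 2"
  shows "Lstar v = image_mset (\<lambda>d. min d (v - d)) (mset_set {1..<v})"
proof -
  define m where "m = v div 2"
  have m: "1 \<le> m" "2 * m \<le> v" "v \<le> 2 * m + 1" using assms by (auto simp: m_def)
  \<comment> \<open>The lower bound \<open>m + 1\<close> is written in the form of
    \<open>image_mset_reflect\<close> with \<open>b = v - m\<close>.\<close>
  have "{1..<v} = {1..m} \<union> {v - (v - m) + 1..<v}" using m by auto
  then have "mset_set {1..<v} = mset_set {1..m} + mset_set {v - (v - m) + 1..<v}"
    using m by (simp only:) (rule mset_set_Union, auto)
  moreover have "image_mset (\<lambda>d. min d (v - d)) (mset_set {1..m}) = mset_set {1..m}"
    using m by (intro image_mset_min_eq) auto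
  moreover have "image_mset (\<lambda>d. min d (v - d)) (mset_set {v - (v - m) + 1..<v}) =
      image_mset (\<lambda>d. v - d) (mset_set {v - (v - m) + 1..<v})"
    using m by (intro image_mset_cong) auto
  ultimately have "image_mset (\<lambda>d. min d (v - d)) (mset_set {1..<v}) =
      mset_set {1..m} + mset_set {1..<v - m}"
    using image_mset_reflect[of "v - m" v] by simp
  also have "\<dots> = Lstar v"
    using assms m by (intro multiset_eqI) (auto simp: count_Lstar count_mset_set' m_def[symmetric])
  finally show ?thesis ..
qed

text \<open>The summands belong to the \<open>v - k - 1\<close> vertices above \<open>k\<close>, the
  two edges to be replaced, and the \<open>k\<close> vertices below \<open>k\<close>; the
  differences \<open>v - k - 1\<close> and \<open>v - k\<close> fold to \<open>k + 1\<close> and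
  \<open>k\<close>.\<close>

lemma Lstar_split:
  assumes "1 \<le> k" "2 * k + 2 \<le> v"
  shows "Lstar v = image_mset (\<lambda>d. min d (v - d)) (mset_set {1..<v - k - 1})
    + {#k, k + 1#} + mset_set {1..<k}"
proof -
  have "{1..<v} = {1..<v - k - 1} \<union> ({v - k - 1, v - k} \<union> {v - k + 1..<v})"
    using assms by auto
  then have "mset_set {1..<v} =
      mset_set {1..<v - k - 1} + (mset_set {v - k - 1, v - k} + mset_set {v - k + 1..<v})"
    by (simp only:) (subst mset_set_Union; (subst mset_set_Union)?; auto)
  moreover have "image_mset (\<lambda>d. min d (v - d)) (mset_set {v - k + 1..<v}) =
      image_mset (\<lambda>d. v - d) (mset_set {v - k + 1..<v})"
    using assms by (intro image_mset_cong) auto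
  moreover have "image_mset (\<lambda>d. min d (v - d)) (mset_set {v - k - 1, v - k}) = {#k, k + 1#}"
    using assms by auto
  ultimately show ?thesis
    using assms image_mset_reflect[of k v] by (simp add: Lstar_eq_image)
qed

section \<open>Hamiltonian paths and the necessity of the divisor condition\<close>

lemma hamiltonian_path_complete:
  "hamiltonian_path {0..<v} (complete_edges v) xs \<longleftrightarrow> set xs = {0..<v} \<and> distinct xs"
proof -
  have "successively (\<lambda>x y. {x, y} \<in> complete_edges v) xs"
    if "distinct xs" "set xs \<subseteq> {0..<v}"
    using that by (induction xs rule: diffs.induct) (auto simp: complete_edges_def)
  then show ?thesis by (auto simp: hamiltonian_path_def)
qed

text \<open>Modulo \<open>v\<close>, and so modulo \<open>d\<close>, the edge length is
  \<open>x - y\<close> up to sign.\<close>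

lemma mod_eq_if_dvd_edge_length:
  assumes "x < v" "y < v" "d dvd v" "d dvd edge_length v x y"
  shows "x mod d = y mod d"
proof -
  have dv: "int d dvd int v" "int d dvd int (edge_length v x y)"
    using assms by (auto simp: int_dvd_int_iff)
  consider "int (edge_length v x y) = int x - int y"
    | "int (edge_length v x y) = int y - int x"
    | "int (edge_length v x y) = int v - (int x - int y)"
    | "int (edge_length v x y) = int v - (int y - int x)"
    using assms unfolding edge_length_def min_def by (cases "x \<le> y") (auto split: if_splits)
  then have "int d dvd int x - int y"
  proof cases
    case 1
    with dv show ?thesis by simp
  next
    case 2
    with dv show ?thesis by (simp add: dvd_diff_commute)
  next
    case 3
    with dvd_diff[OF dv] show ?thesis by simp
  next
    case 4
    with dvd_diff[OF dv] show ?thesis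
      by (simp add: dvd_diff_commute)
  qed
  then show ?thesis
    by (metis mod_eq_dvd_iff of_nat_eq_iff zmod_int)
qed

text \<open>Prepending a vertex adds at most one to the left side: if the new length is a multiple
  of \<open>d\<close>, the residue of the vertex already occurs.\<close>

lemma residues_plus_multiples_le_length:
  assumes "d dvd v" "set xs \<subseteq> {0..<v}"
  shows "card ((\<lambda>x. x mod d) ` set xs) + size {#l \<in># path_lengths v xs. d dvd l#} \<le> length xs"
  using assms
proof (induction xs rule: diffs.induct)
  case (1 x y zs)
  let ?R = "(\<lambda>x. x mod d) ` set (y # zs)"
  have R: "(\<lambda>x. x mod d) ` set (x # y # zs) = insert (x mod d) ?R" by simp
  have IH: "card ?R + size {#l \<in># path_lengths v (y # zs). d dvd l#} \<le> length (y # zs)"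
    using 1 by simp
  show ?case
  proof (cases "d dvd edge_length v x y")
    case True
    then have "x mod d \<in> ?R"
      using mod_eq_if_dvd_edge_length[of x v y d] 1 by auto
    then show ?thesis unfolding R using IH True by (simp add: path_lengths_Cons insert_absorb)
  next
    case False
    have "card (insert (x mod d) ?R) \<le> Suc (card ?R)" by (rule card_insert_le_m1) auto
    then show ?thesis unfolding R using IH False by (simp add: path_lengths_Cons)
  qed
qed (auto simp: path_lengths_def)

lemma realizable_multiples_le:
  assumes "realizable v L" "d dvd v" "v > 0"
  shows "size {#l \<in># L. d dvd l#} \<le> v - d"
proof -
  obtain xs where xs: "set xs = {0..<v}" "distinct xs" "path_lengths v xs = L"
    using assms by (auto simp: realizable_def hamiltonian_path_complete)
  have d: "0 < d" "d \<le> v" using assms by (auto intro: dvd_imp_le gr0I)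
  have "{0..<d} \<subseteq> (\<lambda>x. x mod d) ` set xs"
  proof
    fix r assume "r \<in> {0..<d}"
    then have "r = r mod d" "r \<in> set xs" using d xs by auto
    then show "r \<in> (\<lambda>x. x mod d) ` set xs" by (rule image_eqI)
  qed
  then have "d \<le> card ((\<lambda>x. x mod d) ` set xs)"
    using card_mono[of "(\<lambda>x. x mod d) ` set xs" "{0..<d}"] by simp
  moreover have "length xs = v" using xs distinct_card by fastforce
  ultimately show ?thesis
    using residues_plus_multiples_le_length[OF assms(2), of xs] xs by simp
qed

section \<open>Joining two graceful paths at the vertex \<open>k\<close>\<close>

theorem theorem6p2:
  fixes v m k z1 z2 :: nat and L :: "nat multiset"
  assumes "v = 2 * m \<or> v = 2 * m + 1"
    and "m \<ge> 2"
    and "1 \<le> k" and "k < m"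
    and "1 \<le> z1" and "z1 \<le> k"
    and "1 \<le> z2" and "z2 \<le> m"
    and "L = (Lstar v - {#k, k + 1#}) + {#z1, z2#}"
  shows "BHR v L \<and>
    (\<exists>xs. hamiltonian_path {0..<v} (complete_edges v) xs \<and> path_lengths v xs = L)"
proof -
  let ?f = "\<lambda>d. min d (v - d)"
  define w where "w = v - k - 1"
  have w: "m \<le> w" "v = w + k + 1" and kv: "2 * k + 2 \<le> v" using assms by (auto simp: w_def)
  \<comment> \<open>The starts lie at distance \<open>z1\<close> below \<open>k\<close> and, after
    the shift by \<open>k + 1\<close>, at distance \<open>z2\<close> above it;
    \<open>m \<le> w\<close> ensures \<open>z2 - 1 < w\<close>.\<close>
  obtain xs where xs: "graceful_path k xs" "hd xs = k - z1"
    using graceful_path_exists[of "k - z1" k] assms by auto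
  obtain ys where ys: "graceful_path w ys" "hd ys = z2 - 1"
    using graceful_path_exists[of "z2 - 1" w] assms(2,7,8) w(1) by fastforce
  have xs': "xs \<noteq> []" "set xs = {0..<k}" and ys': "ys \<noteq> []" "set ys = {0..<w}"
    using xs ys assms w by (auto simp: graceful_path_def)
  define zs where "zs = map (\<lambda>x. x + (k + 1)) ys"
  define H where "H = rev xs @ k # zs"
  have setz: "set zs = {k + 1..<w + (k + 1)}"
    using image_add_atLeastLessThan'[of "k + 1" 0 w] ys' by (simp only: zs_def set_map add_0)
  have z: "zs \<noteq> []" "length zs = length ys" "diffs zs = diffs ys"
    using ys' by (simp_all only: zs_def diffs_shift length_map list.map_disc_iff) simp
  have hdz: "hd zs = k + z2" using ys ys' assms(7) by (simp add: zs_def hd_map)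
  have setH: "set H = {0..<v}"
    using xs' setz w by (auto simp: H_def)
  moreover have "length H = v"
    using xs ys z w by (simp add: H_def graceful_path_def)
  ultimately have ham: "hamiltonian_path {0..<v} (complete_edges v) H"
    by (simp add: hamiltonian_path_complete card_distinct)
  have "diffs (k # zs) = z2 # diffs ys"
    using diffs_append[of "[k]" zs] z hdz by simp
  then have "diffs H = rev (diffs xs) @ z1 # z2 # diffs ys"
    using xs' xs assms by (simp add: H_def diffs_append diffs_rev last_rev)
  then have "mset (diffs H) = mset_set {1..<k} + {#z1, z2#} + mset_set {1..<w}"
    using xs ys by (simp add: graceful_path_mset_diffs)
  \<comment> \<open>Only differences of the right path can exceed \<open>v div 2\<close>; all others
    fold to themselves.\<close>
  moreover have "image_mset ?f (mset_set {1..<k}) = mset_set {1..<k}"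
    using kv by (intro image_mset_min_eq) auto
  moreover have "?f z1 = z1" "?f z2 = z2" using assms by auto
  ultimately have "path_lengths v H =
      mset_set {1..<k} + {#z1, z2#} + image_mset ?f (mset_set {1..<w})"
    using setH by (simp add: path_lengths_eq_diffs)
  also have "\<dots> = L"
    using Lstar_split[OF assms(3) kv] assms(9) by (simp add: w_def)
  finally have H: "path_lengths v H = L" .
  then have "realizable v L" using ham by (auto simp: realizable_def)
  \<comment> \<open>Since \<open>L\<close> is realizable, what remains is the divisor condition,
    which is necessary for realizability.\<close>
  then have "BHR v L"
    using realizable_multiples_le kv unfolding BHR_def by simp
  then show ?thesis using ham H by auto
qed

end
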